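(* Let $X$ be a reflexive real Banach space with dual $X^\ast$, let $S\colon X\rightrightarrows X^\ast$ be maximally monotone, let $h\in\mathcal{H}(S)$, and let $T\colon X\rightrightarrows X^\ast$ be a point-to-set operator. Let $y\in\operatorname{dom} T$. Then: (i) If $\operatorname{dom} S$ is bounded, then $\mathcal{D}_T^{\flat,h}(\cdot,y)$ is supercoercive and hence coercive. Suppose further that $Ty$ is compact with respect to the strong topology. Then the following hold: (ii) If $S$ is coercive in the sense that, for all sequences, $(a_n,b_n)\in\mathcal{G}(S)$ and $\|a_n\|\to\infty$ imply $\|b_n\|\to\infty$, then $\mathcal{D}_T^{\flat,h}(\cdot,y)$ is coercive. (iii) If, for all sequences, $(a_n,b_n)\in\mathcal{G}(S)$ and $\|a_n\|\to\infty$ imply $\|b_n\|^2/\|a_n\|\to\infty$, then $\mathcal{D}_T^{\flat,h}(\cdot,y)$ is supercoercive.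
   Context: For a maximally monotone operator $S\colon X\rightrightarrows X^\ast$ with graph $\mathcal{G}(S)$, a function $h\colon X\times X^\ast\to\left]-\infty,+\infty\right]$ represents $S$, written $h\in\mathcal{H}(S)$, if (a) $h$ is convex and norm $\times$ weak$^\ast$ lower semicontinuous; (b) $h(x,v)\geq\langle x,v\rangle$ for all $(x,v)\in X\times X^\ast$; (c) $h(x,v)=\langle x,v\rangle$ if and only if $(x,v)\in\mathcal{G}(S)$. For an operator $A$, $\operatorname{dom} A=\{x: Ax\neq\varnothing\}$. Generalized Bregman distance: for $(x,y)\in\operatorname{dom} S\times\operatorname{dom} T$, $$\mathcal{D}_T^{\flat,h}(x,y):=\inf_{v\in Ty}\big(h(x,v)-\langle x,v\rangle\big),$$ and $\mathcal{D}_T^{\flat,h}(x,y):=+\infty$ if $x\notin\operatorname{dom} S$ or $y\notin\operatorname{dom} T$. A function $g\colon X\to\left]-\infty,+\infty\right]$ is coercive if $\lim_{\|x\|\to\infty}g(x)=\infty$ and supercoercive if $\lim_{\|x\|\to\infty}g(x)/\|x\|=\infty$. *)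

theory Defs
  imports "HOL-Analysis.Analysis"
begin

text \<open>
  The dual of a real normed space \<open>'a\<close> is the type \<open>'a \<Rightarrow>\<^sub>L real\<close>, whose norm is the operator norm.
  A point-to-set operator from \<open>'a\<close> to its dual is a set-valued function.
\<close>

type_synonym 'a dual = "'a \<Rightarrow>\<^sub>L real"

definition reflexive_space :: "'a::real_normed_vector itself \<Rightarrow> bool" where
  "reflexive_space _ \<longleftrightarrow>
     (\<forall>\<phi> :: 'a dual \<Rightarrow>\<^sub>L real. \<exists>x::'a. \<forall>f. blinfun_apply \<phi> f = blinfun_apply f x)"

text \<open>
  For functionals, the strong operator topology (the topology of pointwise convergence)
  is the weak-star topology.
\<close>

abbreviation weak_star_topology :: "'a::real_normed_vector dual topology" where
  "weak_star_topology \<equiv> strong_operator_topology"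

definition op_graph :: "('a::real_normed_vector \<Rightarrow> 'a dual set) \<Rightarrow> ('a \<times> 'a dual) set" where
  "op_graph S = {(x, v). v \<in> S x}"

definition op_dom :: "('a::real_normed_vector \<Rightarrow> 'a dual set) \<Rightarrow> 'a set" where
  "op_dom S = {x. S x \<noteq> {}}"

definition monotone_operator :: "('a::real_normed_vector \<Rightarrow> 'a dual set) \<Rightarrow> bool" where
  "monotone_operator S \<longleftrightarrow>
     (\<forall>(x, u) \<in> op_graph S. \<forall>(y, v) \<in> op_graph S. 0 \<le> blinfun_apply (u - v) (x - y))"

definition maximally_monotone :: "('a::real_normed_vector \<Rightarrow> 'a dual set) \<Rightarrow> bool" where
  "maximally_monotone S \<longleftrightarrow>
     monotone_operator S \<and>
     (\<forall>S'. monotone_operator S' \<longrightarrow> op_graph S \<subseteq> op_graph S' \<longrightarrow> op_graph S' = op_graph S)"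

definition convex_ereal :: "('b::real_vector \<Rightarrow> ereal) \<Rightarrow> bool" where
  "convex_ereal f \<longleftrightarrow>
     (\<forall>z w. \<forall>t::real. 0 < t \<longrightarrow> t < 1 \<longrightarrow>
        f ((1 - t) *\<^sub>R z + t *\<^sub>R w) \<le> ereal (1 - t) * f z + ereal t * f w)"

definition lower_semicontinuous_in :: "'b topology \<Rightarrow> ('b \<Rightarrow> ereal) \<Rightarrow> bool" where
  "lower_semicontinuous_in \<tau> f \<longleftrightarrow> (\<forall>r. openin \<tau> {z \<in> topspace \<tau>. r < f z})"

definition represents :: "('a::real_normed_vector \<times> 'a dual \<Rightarrow> ereal) \<Rightarrow> ('a \<Rightarrow> 'a dual set) \<Rightarrow> bool" where
  "represents h S \<longleftrightarrow>
     (\<forall>z. h z \<noteq> -\<infinity>) \<and>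
     convex_ereal h \<and>
     lower_semicontinuous_in (prod_topology euclidean weak_star_topology) h \<and>
     (\<forall>x v. ereal (blinfun_apply v x) \<le> h (x, v)) \<and>
     (\<forall>x v. h (x, v) = ereal (blinfun_apply v x) \<longleftrightarrow> (x, v) \<in> op_graph S)"

text \<open>
  The operator \<open>S\<close> is an explicit argument because the distance is set to \<open>\<infinity>\<close> outside
  its domain.
\<close>

definition bregman_dist ::
  "('a::real_normed_vector \<Rightarrow> 'a dual set) \<Rightarrow> ('a \<Rightarrow> 'a dual set) \<Rightarrow> ('a \<times> 'a dual \<Rightarrow> ereal)
     \<Rightarrow> 'a \<Rightarrow> 'a \<Rightarrow> ereal" where
  "bregman_dist S T h x y =
     (if x \<in> op_dom S \<and> y \<in> op_dom T
      then (INF v \<in> T y. h (x, v) - ereal (blinfun_apply v x))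
      else \<infinity>)"

text \<open>The filter \<open>at_infinity\<close> is that of \<open>norm x\<close> tending to infinity.\<close>

definition coercive :: "('a::real_normed_vector \<Rightarrow> ereal) \<Rightarrow> bool" where
  "coercive g \<longleftrightarrow> (g \<longlongrightarrow> \<infinity>) at_infinity"

definition supercoercive :: "('a::real_normed_vector \<Rightarrow> ereal) \<Rightarrow> bool" where
  "supercoercive g \<longleftrightarrow> ((\<lambda>x. g x / ereal (norm x)) \<longlongrightarrow> \<infinity>) at_infinity"

definition coercive_operator :: "('a::real_normed_vector \<Rightarrow> 'a dual set) \<Rightarrow> bool" where
  "coercive_operator S \<longleftrightarrow>
     (\<forall>a b. (\<forall>n::nat. (a n, b n) \<in> op_graph S) \<longrightarrow>
        filterlim (\<lambda>n. norm (a n)) at_top sequentially \<longrightarrow>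
        filterlim (\<lambda>n. norm (b n)) at_top sequentially)"

end

theory Submission
  imports Defs
begin

text \<open>
  Let \<open>h (x\<^sub>0, v\<^sub>0)\<close> be finite. Since \<open>h\<close> dominates the pairing, adding to it
  \<open>\<parallel>x - x\<^sub>0\<parallel>\<^sup>2 / 2 + \<parallel>v - v\<^sub>0\<parallel>\<^sup>2 / 2 - \<langle>x, v\<^sub>0\<rangle> - \<langle>x\<^sub>0, v\<rangle> + \<langle>x\<^sub>0, v\<^sub>0\<rangle>\<close> gives a nonnegative
  function, so the two convex summands can be separated by an affine functional. By reflexivity
  that functional is given by a pair \<open>(a, b)\<close>. Maximality of \<open>S\<close> puts \<open>(a, b)\<close> in the graph, and
  evaluating at \<open>(x\<^sub>0, v\<^sub>0)\<close> gives
  \<open>\<parallel>a - x\<^sub>0\<parallel>\<^sup>2 / 2 + \<parallel>b - v\<^sub>0\<parallel>\<^sup>2 / 2 \<le> h (x\<^sub>0, v\<^sub>0) - \<langle>x\<^sub>0, v\<^sub>0\<rangle>\<close>. A failure of coercivity thus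
  produces graph points \<open>(a\<^sub>n, b\<^sub>n)\<close> with \<open>\<parallel>a\<^sub>n\<parallel> \<rightarrow> \<infinity>\<close> for which, as \<open>T y\<close> is bounded, \<open>\<parallel>b\<^sub>n\<parallel>\<close>
  stays bounded (for supercoercivity, \<open>\<parallel>b\<^sub>n\<parallel>\<^sup>2 / \<parallel>a\<^sub>n\<parallel>\<close> does), against the growth hypothesis on \<open>S\<close>.
\<close>

section \<open>A Hahn-Banach theorem for convex functions\<close>

text \<open>Near-minimisers over the two fibres are combined convexly, with an error
  \<open>e\<close> that is arbitrary. This serves twice: for the test function that proves
  superadditivity and for the perturbation function of the sandwich theorem.\<close>

lemma convex_on_partial_INF:
  fixes \<Phi> :: "'a::real_vector \<times> 'b::real_vector \<Rightarrow> real"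
  assumes cv: "convex_on (UNIV \<times> K) \<Phi>" and ne: "K \<noteq> {}"
    and bdd: "\<And>u. bdd_below ((\<lambda>k. \<Phi> (u, k)) ` K)"
  shows "convex_on UNIV (\<lambda>u. INF k\<in>K. \<Phi> (u, k))"
proof (rule convex_onI)
  fix t :: real and x y :: 'a
  assume t: "0 < t" "t < 1"
  define I where "I = (\<lambda>u. INF k\<in>K. \<Phi> (u, k))"
  have "I ((1 - t) *\<^sub>R x + t *\<^sub>R y) \<le> (1 - t) * I x + t * I y"
  proof (rule field_le_epsilon)
    fix e :: real assume e: "e > 0"
    have near: "\<exists>k\<in>K. \<Phi> (u, k) < I u + e" for u
      using cINF_less_iff[OF ne bdd[of u], of "I u + e"] e unfolding I_def by simp
    obtain k where k: "k \<in> K" "\<Phi> (x, k) < I x + e" using near by blast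
    obtain l where l: "l \<in> K" "\<Phi> (y, l) < I y + e" using near by blast
    have "convex ((UNIV :: 'a set) \<times> K)" using cv by (rule convex_on_imp_convex)
    then have "(1 - t) *\<^sub>R (x, k) + t *\<^sub>R (y, l) \<in> UNIV \<times> K"
      using k(1) l(1) t by (intro convexD) auto
    then have kl: "(1 - t) *\<^sub>R k + t *\<^sub>R l \<in> K" by simp
    have "I ((1 - t) *\<^sub>R x + t *\<^sub>R y) \<le> \<Phi> ((1 - t) *\<^sub>R x + t *\<^sub>R y, (1 - t) *\<^sub>R k + t *\<^sub>R l)"
      unfolding I_def by (rule cINF_lower[OF bdd kl])
    also have "\<dots> \<le> (1 - t) * \<Phi> (x, k) + t * \<Phi> (y, l)"
      using convex_onD[OF cv, of t "(x, k)" "(y, l)"] k(1) l(1) t by simp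
    also have "\<dots> \<le> (1 - t) * (I x + e) + t * (I y + e)"
      using k(2) l(2) t by (intro add_mono mult_left_mono) auto
    also have "\<dots> = (1 - t) * I x + t * I y + e" by (simp add: algebra_simps)
    finally show "I ((1 - t) *\<^sub>R x + t *\<^sub>R y) \<le> (1 - t) * I x + t * I y + e" .
  qed
  then show "(INF k\<in>K. \<Phi> ((1 - t) *\<^sub>R x + t *\<^sub>R y, k))
      \<le> (1 - t) * (INF k\<in>K. \<Phi> (x, k)) + t * (INF k\<in>K. \<Phi> (y, k))"
    unfolding I_def .
qed simp

text \<open>Midpoint convexity at the origin. For \<open>0 \<le> q 0\<close> and
  \<open>q \<le> p\<close> it bounds \<open>q x\<close> below by \<open>- p (- x)\<close>, uniformly
  in \<open>q\<close>, so that infima over chains of such \<open>q\<close> are real.\<close>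

lemma convex_on_reflect_lower:
  fixes q :: "'a::real_vector \<Rightarrow> real"
  assumes "convex_on UNIV q"
  shows "2 * q 0 - q (- x) \<le> q x"
  using convex_onD[OF assms, of "1/2" x "- x"] by simp

text \<open>Zorn's lemma applies since the pointwise infimum of a nonempty chain is again convex,
  nonnegative at the origin and below \<open>p\<close>.\<close>

lemma minimal_convex_below:
  fixes p :: "'a::real_vector \<Rightarrow> real"
  assumes p: "convex_on UNIV p" "0 \<le> p 0"
  obtains m where "convex_on UNIV m" "0 \<le> m 0" "m \<le> p"
    and "\<And>q. convex_on UNIV q \<Longrightarrow> 0 \<le> q 0 \<Longrightarrow> q \<le> m \<Longrightarrow> q = m"
proof -
  define A where "A = {q. convex_on UNIV q \<and> 0 \<le> q 0 \<and> q \<le> p}"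
  \<comment> \<open>The order is reversed: a maximal element for \<open>P\<close> is a pointwise
    minimal function.\<close>
  define P where "P = (\<lambda>q r :: 'a \<Rightarrow> real. r \<le> q)"
  have lower: "- p (- x) \<le> q x" if "q \<in> A" for q x
    using that convex_on_reflect_lower[of q x] le_funD[of q p "- x"] unfolding A_def by auto
  have "\<exists>m \<in> A. \<forall>q \<in> A. P m q \<longrightarrow> q = m"
  proof (rule predicate_Zorn)
    show "partial_order_on A (relation_of P A)"
      unfolding P_def by (rule partial_order_on_relation_ofI) auto
  next
    fix C assume "C \<in> Chains (relation_of P A)"
    then have CA: "C \<subseteq> A" and ch: "\<And>q r. q \<in> C \<Longrightarrow> r \<in> C \<Longrightarrow> q \<le> r \<or> r \<le> q"
      unfolding Chains_def relation_of_def P_def by auto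
    show "\<exists>u\<in>A. \<forall>q\<in>C. P q u"
    proof (cases "C = {}")
      case True
      then show ?thesis using p unfolding A_def by auto
    next
      case ne: False
      define I where "I = (\<lambda>x. INF q\<in>C. q x)"
      have bdd: "bdd_below ((\<lambda>q. q x) ` C)" for x
        using lower CA by (intro bdd_belowI2[of _ "- p (- x)"]) auto
      have Ile: "I x \<le> q x" if "q \<in> C" for q x
        unfolding I_def using cINF_lower[OF bdd that] .
      have "convex_on UNIV I"
      proof (rule convex_onI)
        fix t :: real and x y :: 'a assume t: "0 < t" "t < 1"
        show "I ((1 - t) *\<^sub>R x + t *\<^sub>R y) \<le> (1 - t) * I x + t * I y"
        proof (rule field_le_epsilon)
          fix e :: real assume e: "e > 0"
          have near: "\<exists>q\<in>C. q u < I u + e" for u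
            using cINF_less_iff[OF ne bdd[of u], of "I u + e"] e unfolding I_def by simp
          obtain q where q: "q \<in> C" "q x < I x + e" using near by blast
          obtain r where r: "r \<in> C" "r y < I y + e" using near by blast
          \<comment> \<open>Near-minimisers at \<open>x\<close> and \<open>y\<close> may differ.
            Comparability in the chain gives one function that is nearly minimal at both points, and
            its convexity can be used.\<close>
          obtain s where s: "s \<in> C" "s \<le> q" "s \<le> r" using ch q(1) r(1) by blast
          have cs: "convex_on UNIV s" using s(1) CA unfolding A_def by auto
          have "I ((1 - t) *\<^sub>R x + t *\<^sub>R y) \<le> s ((1 - t) *\<^sub>R x + t *\<^sub>R y)" by (rule Ile[OF s(1)])
          also have "\<dots> \<le> (1 - t) * s x + t * s y" using convex_onD[OF cs] t by simp
          also have "\<dots> \<le> (1 - t) * (I x + e) + t * (I y + e)"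
            using q(2) r(2) t le_funD[OF s(2), of x] le_funD[OF s(3), of y]
            by (intro add_mono mult_left_mono) auto
          also have "\<dots> = (1 - t) * I x + t * I y + e" by (simp add: algebra_simps)
          finally show "I ((1 - t) *\<^sub>R x + t *\<^sub>R y) \<le> (1 - t) * I x + t * I y + e" .
        qed
      qed simp
      moreover have "0 \<le> I 0"
        unfolding I_def using ne CA by (intro cINF_greatest) (auto simp: A_def)
      moreover have "I \<le> p"
      proof (rule le_funI)
        fix x
        obtain q where "q \<in> C" using ne by blast
        then show "I x \<le> p x" using Ile[of q x] CA le_funD[of q p x] unfolding A_def by force
      qed
      ultimately have "I \<in> A" unfolding A_def by auto
      then show ?thesis using Ile unfolding P_def le_fun_def by blast
    qed
  qed
  then obtain m where "m \<in> A" and min: "\<And>q. q \<in> A \<Longrightarrow> q \<le> m \<Longrightarrow> q = m" unfolding P_def by blast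
  then show thesis by (intro that[of m]) (auto simp: A_def intro: order_trans)
qed

text \<open>
  Minimality is tested against \<open>x \<mapsto> m (t x) / t\<close> for homogeneity and against
  \<open>x \<mapsto> inf\<^sub>t (m (x + t y) - t m y)\<close> over \<open>t \<ge> 0\<close> for superadditivity.
\<close>
lemma minimal_convex_linear:
  fixes m :: "'a::real_vector \<Rightarrow> real"
  assumes cv: "convex_on UNIV m" and m0: "0 \<le> m 0"
    and min: "\<And>q. convex_on UNIV q \<Longrightarrow> 0 \<le> q 0 \<Longrightarrow> q \<le> m \<Longrightarrow> q = m"
  shows "linear m"
proof -
  have zero: "m 0 = 0"
  proof -
    have "(\<lambda>x. m x + - m 0) = m"
      using m0 by (intro min convex_on_add cv) (auto simp: le_fun_def convex_on_const)
    then have "m 0 + - m 0 = m 0" by (rule fun_cong)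
    then show ?thesis by simp
  qed
  \<comment> \<open>For \<open>t \<le> 1\<close>, convexity and \<open>m 0 = 0\<close> put the test
    function below \<open>m\<close>. Larger factors follow by scaling back with
    \<open>1 / t\<close>.\<close>
  have hom1: "m (t *\<^sub>R x) = t * m x" if t: "0 < t" "t \<le> 1" for t x
  proof -
    have "(\<lambda>x. m (t *\<^sub>R x) / t) = m"
    proof (rule min)
      show "convex_on UNIV (\<lambda>x. m (t *\<^sub>R x) / t)"
      proof (rule convex_onI)
        fix s :: real and x y :: 'a assume s: "0 < s" "s < 1"
        have "m (t *\<^sub>R ((1 - s) *\<^sub>R x + s *\<^sub>R y)) = m ((1 - s) *\<^sub>R (t *\<^sub>R x) + s *\<^sub>R (t *\<^sub>R y))"
          by (simp add: algebra_simps)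
        also have "\<dots> \<le> (1 - s) * m (t *\<^sub>R x) + s * m (t *\<^sub>R y)"
          using s by (intro convex_onD[OF cv]) auto
        finally show "m (t *\<^sub>R ((1 - s) *\<^sub>R x + s *\<^sub>R y)) / t
            \<le> (1 - s) * (m (t *\<^sub>R x) / t) + s * (m (t *\<^sub>R y) / t)"
          using t by (simp add: divide_simps)
      qed simp
      show "0 \<le> m (t *\<^sub>R 0) / t" using zero by simp
      have "m (t *\<^sub>R x) \<le> t * m x" for x
        using convex_onD[OF cv, of t 0 x] zero t by simp
      then show "(\<lambda>x. m (t *\<^sub>R x) / t) \<le> m"
        using t by (auto simp: le_fun_def divide_simps mult.commute)
    qed
    then have "m (t *\<^sub>R x) / t = m x" by (rule fun_cong)
    then show ?thesis using t by (simp add: field_simps)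
  qed
  have hom: "m (t *\<^sub>R x) = t * m x" if "0 \<le> t" for t x
  proof (cases "t \<le> 1")
    case True
    then show ?thesis using hom1[of t x] that zero by (cases "t = 0") auto
  next
    case False
    then show ?thesis using hom1[of "1 / t" "t *\<^sub>R x"] by (simp add: field_simps)
  qed
  have sub: "m (x + y) \<le> m x + m y" for x y
    using convex_onD[OF cv, of "1/2" "2 *\<^sub>R x" "2 *\<^sub>R y"] hom[of 2] by simp
  have super: "m x + m y \<le> m (x + y)" for x y
  proof -
    \<comment> \<open>The value at \<open>t = 0\<close> places the infimum below \<open>m\<close>,
      so minimality makes it equal to \<open>m\<close>; comparison with \<open>t = 1\<close> is then
      superadditivity.\<close>
    define \<Phi> where "\<Phi> = (\<lambda>(x, t). m (x + t *\<^sub>R y) - t * m y)"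
    have lb: "- m (- x) \<le> \<Phi> (x, t)" if "t \<ge> 0" for x t
      using sub[of "x + t *\<^sub>R y" "- x"] hom[OF that, of y] unfolding \<Phi>_def by simp
    have bdd: "bdd_below ((\<lambda>t. \<Phi> (x, t)) ` {0..})" for x
      using lb by (intro bdd_belowI2[of _ "- m (- x)"]) auto
    have "(\<lambda>x. INF t\<in>{0..}. \<Phi> (x, t)) = m"
    proof (rule min)
      have "convex_on (UNIV \<times> {0..}) \<Phi>"
      proof (rule convex_onI)
        fix s :: real and z w :: "'a \<times> real" assume s: "0 < s" "s < 1"
        obtain x a x' b where z: "z = (x, a)" "w = (x', b)" by fastforce
        have "m (((1 - s) *\<^sub>R x + s *\<^sub>R x') + ((1 - s) * a + s * b) *\<^sub>R y)
            = m ((1 - s) *\<^sub>R (x + a *\<^sub>R y) + s *\<^sub>R (x' + b *\<^sub>R y))"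
          by (simp add: algebra_simps)
        also have "\<dots> \<le> (1 - s) * m (x + a *\<^sub>R y) + s * m (x' + b *\<^sub>R y)"
          using convex_onD[OF cv] s by simp
        finally show "\<Phi> ((1 - s) *\<^sub>R z + s *\<^sub>R w) \<le> (1 - s) * \<Phi> z + s * \<Phi> w"
          unfolding \<Phi>_def z by (simp add: algebra_simps)
      qed (intro convex_Times convex_UNIV convex_real_interval)
      then show "convex_on UNIV (\<lambda>x. INF t\<in>{0..}. \<Phi> (x, t))"
        by (rule convex_on_partial_INF) (use bdd in auto)
      show "0 \<le> (INF t\<in>{0..}. \<Phi> (0, t))"
        using hom by (intro cINF_greatest) (auto simp: \<Phi>_def)
      show "(\<lambda>x. INF t\<in>{0..}. \<Phi> (x, t)) \<le> m"
      proof (rule le_funI)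
        fix x
        show "(INF t\<in>{0..}. \<Phi> (x, t)) \<le> m x"
          using cINF_lower[OF bdd[of x], of 0] by (simp add: \<Phi>_def)
      qed
    qed
    then have "m x = (INF t\<in>{0..}. \<Phi> (x, t))" by (metis (no_types))
    also have "\<dots> \<le> \<Phi> (x, 1)" by (rule cINF_lower[OF bdd]) simp
    finally show ?thesis by (simp add: \<Phi>_def)
  qed
  have add: "m (x + y) = m x + m y" for x y
    using sub super by (intro antisym)
  have neg: "m (- x) = - m x" for x
    using add[of x "- x"] zero by simp
  show ?thesis
  proof (rule linearI)
    show "m (x + y) = m x + m y" for x y by (rule add)
    show "m (t *\<^sub>R x) = t *\<^sub>R m x" for t x
      using hom[of t x] hom[of "- t" x] neg[of "t *\<^sub>R x"] by (cases "0 \<le> t") auto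
  qed
qed

text \<open>The functional is purely algebraic, and a convex \<open>p\<close> takes the place of a
  sublinear one. Continuity is recovered later from quadratic bounds.\<close>

theorem hahn_banach_convex:
  fixes p :: "'a::real_vector \<Rightarrow> real"
  assumes "convex_on UNIV p" "0 \<le> p 0"
  obtains L where "linear L" "\<And>x. L x \<le> p x"
  using minimal_convex_below[OF assms] minimal_convex_linear by (metis le_funD)

text \<open>Hahn-Banach is applied to the perturbation function
  \<open>u \<mapsto> inf (F z + G (z - u))\<close>, which is nonnegative at \<open>u = 0\<close>.
  Finiteness of \<open>G\<close> on the whole space keeps this infimum finite for every
  \<open>u\<close>, as an interior-point condition would.\<close>

theorem convex_sandwich:
  fixes F G :: "'a::real_vector \<Rightarrow> real"
  assumes F: "convex_on C F" and G: "convex_on UNIV G" and ne: "C \<noteq> {}"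
    and pos: "\<And>z. z \<in> C \<Longrightarrow> 0 \<le> F z + G z"
  obtains L where "linear L" "\<And>z k. z \<in> C \<Longrightarrow> L z - L k \<le> F z + G k"
proof -
  define \<Phi> where "\<Phi> = (\<lambda>(u, z). F z + G (z - u))"
  have C: "convex C" using F by (rule convex_on_imp_convex)
  obtain z0 where z0: "z0 \<in> C" using ne by blast
  have cv\<Phi>: "convex_on (UNIV \<times> C) \<Phi>"
  proof (rule convex_onI)
    fix s :: real and a b :: "'a \<times> 'a"
    assume s: "0 < s" "s < 1" and ab: "a \<in> UNIV \<times> C" "b \<in> UNIV \<times> C"
    obtain u z v w where a: "a = (u, z)" "b = (v, w)" by fastforce
    have "G (((1 - s) *\<^sub>R z + s *\<^sub>R w) - ((1 - s) *\<^sub>R u + s *\<^sub>R v))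
        = G ((1 - s) *\<^sub>R (z - u) + s *\<^sub>R (w - v))"
      by (simp add: algebra_simps)
    also have "\<dots> \<le> (1 - s) * G (z - u) + s * G (w - v)"
      using convex_onD[OF G] s by simp
    finally show "\<Phi> ((1 - s) *\<^sub>R a + s *\<^sub>R b) \<le> (1 - s) * \<Phi> a + s * \<Phi> b"
      using convex_onD[OF F, of s z w] s ab unfolding \<Phi>_def a by (simp add: algebra_simps)
  qed (intro convex_Times convex_UNIV C)
  \<comment> \<open>The midpoint of \<open>z\<close> and \<open>z0\<close> is also the midpoint of
    \<open>z - u\<close> and \<open>z0 + u\<close>, so \<open>pos\<close> at this one point bounds
    \<open>F z + G (z - u)\<close> from below.\<close>
  have lb: "- F z0 - G (z0 + u) \<le> \<Phi> (u, z)" if "z \<in> C" for u z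
  proof -
    define w where "w = (1/2) *\<^sub>R z + (1/2) *\<^sub>R z0"
    have w: "w \<in> C" unfolding w_def using C that z0 by (intro convexD) auto
    have "w = (1 - 1/2) *\<^sub>R (z - u) + (1/2) *\<^sub>R (z0 + u)"
      unfolding w_def by (simp add: algebra_simps)
    then have "G w \<le> (1/2) * G (z - u) + (1/2) * G (z0 + u)"
      using convex_onD[OF G, of "1/2" "z - u" "z0 + u"] by simp
    moreover have "F w \<le> (1/2) * F z + (1/2) * F z0"
      unfolding w_def using convex_onD[OF F, of "1/2" z z0] that z0 by simp
    ultimately show ?thesis using pos[OF w] unfolding \<Phi>_def by simp
  qed
  have bdd: "bdd_below ((\<lambda>z. \<Phi> (u, z)) ` C)" for u
    using lb by (intro bdd_belowI2[of _ "- F z0 - G (z0 + u)"]) auto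
  have "convex_on UNIV (\<lambda>u. INF z\<in>C. \<Phi> (u, z))"
    by (rule convex_on_partial_INF[OF cv\<Phi> ne bdd])
  moreover have "0 \<le> (INF z\<in>C. \<Phi> (0, z))"
    using pos ne by (intro cINF_greatest) (auto simp: \<Phi>_def)
  ultimately obtain L where L: "linear L" "\<And>u. L u \<le> (INF z\<in>C. \<Phi> (u, z))"
    using hahn_banach_convex[of "\<lambda>u. INF z\<in>C. \<Phi> (u, z)"] by blast
  have "L z - L k \<le> F z + G k" if "z \<in> C" for z k
  proof -
    have "L (z - k) \<le> \<Phi> (z - k, z)"
      using L(2)[of "z - k"] cINF_lower[OF bdd that, of "z - k"] by linarith
    then show ?thesis using L(1) by (simp add: \<Phi>_def linear_diff)
  qed
  then show thesis using that L(1) by blast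
qed

section \<open>Half squared norms\<close>

text \<open>One half of the fact that the conjugate of the half squared norm is the half squared
  dual norm. A finite conjugate value also forces \<open>L\<close> to be bounded.\<close>

lemma linear_half_square_bound:
  fixes L :: "'a::real_normed_vector \<Rightarrow> real"
  assumes L: "linear L" and le: "\<And>x. L x - (norm x)\<^sup>2 / 2 \<le> r"
  obtains f :: "'a dual" where "blinfun_apply f = L" "(norm f)\<^sup>2 / 2 \<le> r"
proof -
  have r: "0 \<le> r" using le[of 0] linear_0[OF L] by simp
  have bd: "\<bar>L x\<bar> \<le> sqrt (2 * r) * norm x" for x
  proof (cases "x = 0")
    case True
    then show ?thesis using linear_0[OF L] by simp
  next
    case False
    then have n: "norm x > 0" by simp
    \<comment> \<open>The factor \<open>L x / (norm x)\<^sup>2\<close> maximises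
      \<open>t * L x - t\<^sup>2 * (norm x)\<^sup>2 / 2\<close> over real \<open>t\<close>.\<close>
    have "(L x / (norm x)\<^sup>2) * L x - ((L x / (norm x)\<^sup>2) * norm x)\<^sup>2 / 2 \<le> r"
      using le[of "(L x / (norm x)\<^sup>2) *\<^sub>R x"] linear_cmul[OF L]
      by (simp add: power_mult_distrib power_divide)
    moreover have "(L x / (norm x)\<^sup>2) * L x - ((L x / (norm x)\<^sup>2) * norm x)\<^sup>2 / 2
        = (L x)\<^sup>2 / (norm x)\<^sup>2 / 2"
      using n by (simp add: field_simps power2_eq_square)
    ultimately have "(L x)\<^sup>2 / (norm x)\<^sup>2 / 2 \<le> r" by linarith
    then have "(L x)\<^sup>2 \<le> 2 * r * (norm x)\<^sup>2"
      using n by (simp add: field_simps)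
    then have "sqrt ((L x)\<^sup>2) \<le> sqrt (2 * r * (norm x)\<^sup>2)" by (rule real_sqrt_le_mono)
    then show ?thesis by (simp add: real_sqrt_mult)
  qed
  have bl: "bounded_linear L"
    using bd linear_add[OF L] linear_cmul[OF L]
    by (intro bounded_linear_intro[of _ "sqrt (2 * r)"]) (auto simp: mult.commute)
  have ap: "blinfun_apply (Blinfun L) = L" using bl by (rule bounded_linear_Blinfun_apply)
  have "norm (Blinfun L) \<le> sqrt (2 * r)"
    using bd r by (intro norm_blinfun_bound) (auto simp: ap)
  then have "(norm (Blinfun L))\<^sup>2 \<le> (sqrt (2 * r))\<^sup>2" by (intro power_mono) auto
  then have "(norm (Blinfun L))\<^sup>2 / 2 \<le> r" using r by simp
  then show thesis using that ap by blast
qed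

lemma convex_on_half_norm_square:
  "convex_on UNIV (\<lambda>x::'a::real_normed_vector. (norm (x - a))\<^sup>2 / 2)"
proof (rule convex_onI)
  fix t :: real and x y :: 'a assume t: "0 < t" "t < 1"
  have "norm ((1 - t) *\<^sub>R x + t *\<^sub>R y - a) = norm ((1 - t) *\<^sub>R (x - a) + t *\<^sub>R (y - a))"
    by (simp add: algebra_simps)
  also have "\<dots> \<le> (1 - t) * norm (x - a) + t * norm (y - a)"
    using t by (intro norm_triangle_le) simp
  finally have "(norm ((1 - t) *\<^sub>R x + t *\<^sub>R y - a))\<^sup>2
      \<le> ((1 - t) * norm (x - a) + t * norm (y - a))\<^sup>2" by (intro power_mono) auto
  also have "\<dots> \<le> (1 - t) * (norm (x - a))\<^sup>2 + t * (norm (y - a))\<^sup>2"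
    using convex_onD[OF convex_power2, of t "norm (x - a)" "norm (y - a)"] t by simp
  finally show "(norm ((1 - t) *\<^sub>R x + t *\<^sub>R y - a))\<^sup>2 / 2
      \<le> (1 - t) * ((norm (x - a))\<^sup>2 / 2) + t * ((norm (y - a))\<^sup>2 / 2)" by simp
qed simp

text \<open>A subgradient of the half squared norm at \<open>w\<close> gives equality in
  Fenchel-Young, so testing \<open>le\<close> with it suffices. Here \<open>p\<close> is the half
  squared norm recentred so that a linear minorant of it is such a subgradient.\<close>

lemma half_square_dual_bound:
  fixes w :: "'a::real_normed_vector"
  assumes le: "\<And>v :: 'a dual. blinfun_apply v w - (norm v)\<^sup>2 / 2 \<le> r"
  shows "(norm w)\<^sup>2 / 2 \<le> r"
proof -
  define p where "p = (\<lambda>u. (norm (u - (- w)))\<^sup>2 / 2 + - ((norm w)\<^sup>2 / 2))"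
  have "convex_on UNIV p"
    unfolding p_def by (intro convex_on_add convex_on_half_norm_square) (simp add: convex_on_const)
  moreover have "0 \<le> p 0" by (simp add: p_def)
  ultimately obtain L where L: "linear L" and Lp: "\<And>u. L u \<le> p u"
    using hahn_banach_convex by blast
  have "L x - (norm x)\<^sup>2 / 2 \<le> L w - (norm w)\<^sup>2 / 2" for x
    using Lp[of "x - w"] linear_diff[OF L] by (simp add: p_def)
  then obtain f :: "'a dual" where "blinfun_apply f = L" "(norm f)\<^sup>2 / 2 \<le> L w - (norm w)\<^sup>2 / 2"
    using linear_half_square_bound[OF L] by blast
  then show ?thesis using le[of f] by simp
qed

lemma blinfun_half_square_bound:
  fixes f :: "'a::real_normed_vector dual"
  assumes "\<And>x. blinfun_apply f x - (norm x)\<^sup>2 / 2 \<le> r"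
  shows "(norm f)\<^sup>2 / 2 \<le> r"
proof -
  have "linear (blinfun_apply f)"
    by (simp add: bounded_linear.linear blinfun.bounded_linear_right)
  then obtain g :: "'a dual" where "blinfun_apply g = blinfun_apply f" "(norm g)\<^sup>2 / 2 \<le> r"
    using linear_half_square_bound assms by blast
  then show ?thesis by (simp add: blinfun_apply_inject)
qed

section \<open>Graph points near a point of small gap\<close>

text \<open>Adjoining \<open>(a, b)\<close> to the graph gives a monotone extension, which
  maximality forces to be trivial.\<close>

lemma maximally_monotone_memI:
  assumes max: "maximally_monotone S"
    and mono: "\<And>x v. (x, v) \<in> op_graph S \<Longrightarrow> 0 \<le> blinfun_apply (v - b) (x - a)"
  shows "(a, b) \<in> op_graph S"
proof -
  define S' where "S' = S(a := insert b (S a))"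
  have gr: "op_graph S' = insert (a, b) (op_graph S)"
    unfolding S'_def op_graph_def by (auto split: if_splits)
  have sym: "blinfun_apply (v - b) (x - a) = blinfun_apply (b - v) (a - x)" for x v
    by (simp add: blinfun.bilinear_simps)
  have "monotone_operator S'"
    using max mono unfolding maximally_monotone_def monotone_operator_def gr
    by (auto simp flip: sym)
  then have "op_graph S' = op_graph S"
    using max gr unfolding maximally_monotone_def by blast
  then show ?thesis using gr by blast
qed

text \<open>Restriction to the effective domain makes \<open>h\<close> an admissible real-valued
  summand for the sandwich theorem.\<close>

lemma convex_on_real_of_ereal:
  assumes cv: "convex_ereal f" and pr: "\<And>z. f z \<noteq> -\<infinity>"
  shows "convex_on {z. f z \<noteq> \<infinity>} (\<lambda>z. real_of_ereal (f z))"
proof -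
  have le: "f ((1 - t) *\<^sub>R z + t *\<^sub>R w) \<le> ereal ((1 - t) * real_of_ereal (f z) + t * real_of_ereal (f w))"
    if "0 < t" "t < 1" "f z \<noteq> \<infinity>" "f w \<noteq> \<infinity>" for t :: real and z w
  proof -
    have "f ((1 - t) *\<^sub>R z + t *\<^sub>R w) \<le> ereal (1 - t) * f z + ereal t * f w"
      using cv that unfolding convex_ereal_def by blast
    then show ?thesis
      using pr[of z] pr[of w] that by (cases "f z"; cases "f w") auto
  qed
  show ?thesis
  proof (rule convex_onI)
    fix t :: real and z w assume "0 < t" "t < 1" "z \<in> {z. f z \<noteq> \<infinity>}" "w \<in> {z. f z \<noteq> \<infinity>}"
    then show "real_of_ereal (f ((1 - t) *\<^sub>R z + t *\<^sub>R w))
        \<le> (1 - t) * real_of_ereal (f z) + t * real_of_ereal (f w)"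
      using le[of t z w] pr[of "(1 - t) *\<^sub>R z + t *\<^sub>R w"]
      by (cases "f ((1 - t) *\<^sub>R z + t *\<^sub>R w)") auto
  next
    show "convex {z. f z \<noteq> \<infinity>}"
      unfolding convex_alt
    proof (intro ballI allI impI)
      fix z w and t :: real
      assume z: "z \<in> {z. f z \<noteq> \<infinity>}" "w \<in> {z. f z \<noteq> \<infinity>}" and t: "0 \<le> t \<and> t \<le> 1"
      consider "t = 0" | "t = 1" | "0 < t" "t < 1" using t by linarith
      then show "(1 - t) *\<^sub>R z + t *\<^sub>R w \<in> {z. f z \<noteq> \<infinity>}"
        using z le[of t z w] by cases auto
    qed
  qed
qed

text \<open>An estimate of Bronsted-Rockafellar type: the gap between \<open>h\<close> and the
  pairing controls the distance to the graph in both components at once.\<close>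

lemma represents_near_graph:
  fixes S :: "'a::real_normed_vector \<Rightarrow> 'a dual set"
  assumes refl: "reflexive_space TYPE('a)" and max: "maximally_monotone S"
    and rep: "represents h S" and c: "h (x0, v0) = ereal c"
  obtains a b where "(a, b) \<in> op_graph S"
    "(norm (a - x0))\<^sup>2 / 2 + (norm (b - v0))\<^sup>2 / 2 \<le> c - blinfun_apply v0 x0"
proof -
  define C where "C = {z. h z \<noteq> \<infinity>}"
  define F where "F = (\<lambda>z. real_of_ereal (h z))"
  \<comment> \<open>The affine terms are those of \<open>\<langle>x - x0, v - v0\<rangle>\<close>
    without \<open>\<langle>x, v\<rangle>\<close>, which \<open>F\<close> dominates. Hence
    \<open>F + G\<close> is at least this pairing plus the half squares, which is
    nonnegative.\<close>
  define G where "G = (\<lambda>(x, v). (norm (x - x0))\<^sup>2 / 2 + (norm (v - v0))\<^sup>2 / 2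
      - blinfun_apply v0 x - blinfun_apply v x0 + blinfun_apply v0 x0)"
  have pr: "h z \<noteq> -\<infinity>" and hle: "ereal (blinfun_apply v x) \<le> h (x, v)"
    and hgr: "(x, v) \<in> op_graph S \<Longrightarrow> h (x, v) = ereal (blinfun_apply v x)" for z x v
    using rep unfolding represents_def by blast+
  have cvF: "convex_on C F"
    using rep pr unfolding C_def F_def represents_def by (intro convex_on_real_of_ereal) auto
  have cvG: "convex_on UNIV G"
  proof (rule convex_onI)
    fix t :: real and z w :: "'a \<times> 'a dual" assume t: "0 < t" "t < 1"
    obtain x v x' v' where z: "z = (x, v)" "w = (x', v')" by fastforce
    show "G ((1 - t) *\<^sub>R z + t *\<^sub>R w) \<le> (1 - t) * G z + t * G w"
      using convex_onD[OF convex_on_half_norm_square[of x0], of t x x'] t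
        convex_onD[OF convex_on_half_norm_square[of v0], of t v v']
      unfolding G_def z by (simp add: blinfun.bilinear_simps) (simp add: algebra_simps add_divide_distrib diff_divide_distrib)
  qed simp
  have CF: "blinfun_apply v x \<le> F (x, v)" if "(x, v) \<in> C" for x v
    using hle[of v x] that unfolding C_def F_def by (cases "h (x, v)") auto
  have pairing: "- ((norm x)\<^sup>2 / 2 + (norm v)\<^sup>2 / 2) \<le> blinfun_apply v x" for x :: 'a and v :: "'a dual"
    using norm_blinfun[of v x] sum_squares_bound[of "norm v" "norm x"] by (simp add: abs_le_iff)
  have z0C: "(x0, v0) \<in> C" and Fz0: "F (x0, v0) = c" using c by (auto simp: C_def F_def)
  have "0 \<le> F z + G z" if "z \<in> C" for z
  proof -
    obtain x v where z: "z = (x, v)" by fastforce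
    show ?thesis
      using CF[of x v] that pairing[of "x - x0" "v - v0"] unfolding z G_def
      by (simp add: blinfun.bilinear_simps)
  qed
  then obtain L where L: "linear L" and LFG: "\<And>z k. z \<in> C \<Longrightarrow> L z - L k \<le> F z + G k"
    using convex_sandwich[OF cvF cvG] z0C by blast
  have split: "L (x, v) = L (x, 0) + L (0, v)" for x v
    using linear_add[OF L, of "(x, 0)" "(0, v)"] by simp
  \<comment> \<open>Putting \<open>k = (x0 + x, v0 + v)\<close> in the sandwich inequality leaves
    \<open>A\<close> and \<open>B\<close> as the linear terms set against the half squares, and
    \<open>r z\<close> as the bound free of \<open>x\<close> and \<open>v\<close>.\<close>
  define A where "A = (\<lambda>x. blinfun_apply v0 x - L (x, 0))"
  define B where "B = (\<lambda>v. blinfun_apply v x0 - L (0, v))"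
  have scale: "L (t *\<^sub>R x, 0) = t * L (x, 0)" "L (0, t *\<^sub>R v) = t * L (0, v)" for t x v
    using linear_cmul[OF L, of t "(x, 0)"] linear_cmul[OF L, of t "(0, v)"] by auto
  have plus: "L (x + x', 0) = L (x, 0) + L (x', 0)" "L (0, v + v') = L (0, v) + L (0, v')" for x x' v v'
    using linear_add[OF L, of "(x, 0)" "(x', 0)"] linear_add[OF L, of "(0, v)" "(0, v')"] by auto
  have lin: "linear A" "linear B"
    unfolding A_def B_def
    by (auto intro!: linearI simp: scale plus blinfun.bilinear_simps algebra_simps)
  define r where "r = (\<lambda>z. F z - L z + L (x0, v0) - blinfun_apply v0 x0)"
  have AB: "A x - (norm x)\<^sup>2 / 2 + (B v - (norm v)\<^sup>2 / 2) \<le> r z" if "z \<in> C" for z x v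
    using LFG[OF that, of "(x0 + x, v0 + v)"] linear_add[OF L, of "(x0, v0)" "(x, v)"] split[of x v]
    unfolding A_def B_def r_def G_def by (simp add: blinfun.bilinear_simps)
  have "A x - (norm x)\<^sup>2 / 2 \<le> r (x0, v0)" for x
    using AB[OF z0C, of x 0] linear_0[OF lin(2)] by simp
  then obtain f :: "'a dual" where f: "blinfun_apply f = A"
    using linear_half_square_bound[OF lin(1)] by blast
  have "B v - (norm v)\<^sup>2 / 2 \<le> r (x0, v0)" for v
    using AB[OF z0C, of 0 v] linear_0[OF lin(1)] by simp
  then obtain \<phi> :: "'a dual dual" where \<phi>: "blinfun_apply \<phi> = B"
    using linear_half_square_bound[OF lin(2)] by blast
  \<comment> \<open>\<open>B\<close> is a bounded functional on the dual; reflexivity represents it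
    by a point of the space.\<close>
  obtain w where w: "\<And>v. B v = blinfun_apply v w"
    using refl \<phi> unfolding reflexive_space_def by metis
  \<comment> \<open>The supremum over \<open>x\<close> is taken first, with \<open>v\<close> fixed,
    and the supremum over \<open>v\<close> afterwards.\<close>
  have bound: "(norm f)\<^sup>2 / 2 + (norm w)\<^sup>2 / 2 \<le> r z" if "z \<in> C" for z
  proof -
    have "(norm f)\<^sup>2 / 2 \<le> r z - (blinfun_apply v w - (norm v)\<^sup>2 / 2)" for v
      using AB[OF that, of _ v] by (intro blinfun_half_square_bound) (simp add: f w algebra_simps)
    then have "blinfun_apply v w - (norm v)\<^sup>2 / 2 \<le> r z - (norm f)\<^sup>2 / 2" for v
      by (simp add: algebra_simps)
    then show ?thesis using half_square_dual_bound[of w] by fastforce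
  qed
  define a where "a = x0 - w"
  define b where "b = v0 - f"
  have Lab: "L (x, v) = blinfun_apply b x + blinfun_apply v a" for x v
    using split[of x v] w[of v] fun_cong[OF f, of x]
    unfolding a_def b_def A_def B_def by (simp add: blinfun.bilinear_simps)
  have "(a, b) \<in> op_graph S"
  proof (rule maximally_monotone_memI[OF max])
    fix x v assume "(x, v) \<in> op_graph S"
    then have "(x, v) \<in> C" "F (x, v) = blinfun_apply v x" using hgr by (auto simp: C_def F_def)
    then have "(norm f)\<^sup>2 / 2 + (norm w)\<^sup>2 / 2
        \<le> blinfun_apply v x - L (x, v) + L (x0, v0) - blinfun_apply v0 x0"
      using bound[of "(x, v)"] by (simp add: r_def)
    \<comment> \<open>The right-hand side above equals
      \<open>\<langle>x - a, v - b\<rangle> - \<langle>w, f\<rangle>\<close>, and the half squares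
      absorb \<open>\<langle>w, f\<rangle>\<close>.\<close>
    then show "0 \<le> blinfun_apply (v - b) (x - a)"
      using pairing[of w f] unfolding Lab by (simp add: a_def b_def blinfun.bilinear_simps)
  qed
  moreover have "(norm (a - x0))\<^sup>2 / 2 + (norm (b - v0))\<^sup>2 / 2 \<le> c - blinfun_apply v0 x0"
    using bound[OF z0C] Fz0 by (simp add: r_def a_def b_def)
  ultimately show thesis using that by blast
qed

text \<open>The infimum may fail to be attained; the strict bound provides a \<open>v\<close> in
  \<open>T y\<close> whose gap is below \<open>s\<close>.\<close>

lemma bregman_dist_near_graph:
  fixes S :: "'a::real_normed_vector \<Rightarrow> 'a dual set"
  assumes refl: "reflexive_space TYPE('a)" and max: "maximally_monotone S"
    and rep: "represents h S" and less: "bregman_dist S T h x y < ereal s"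
  obtains a b v where "(a, b) \<in> op_graph S" "v \<in> T y"
    "(norm (a - x))\<^sup>2 \<le> 2 * s" "(norm (b - v))\<^sup>2 \<le> 2 * s"
proof -
  have "(INF v \<in> T y. h (x, v) - ereal (blinfun_apply v x)) < ereal s"
    using less by (auto simp: bregman_dist_def split: if_splits)
  then obtain v where v: "v \<in> T y" "h (x, v) - ereal (blinfun_apply v x) < ereal s"
    unfolding INF_less_iff by blast
  have "h (x, v) \<noteq> -\<infinity>" using rep unfolding represents_def by blast
  then obtain c where c: "h (x, v) = ereal c" "c - blinfun_apply v x < s"
    using v(2) by (cases "h (x, v)") auto
  obtain a b where "(a, b) \<in> op_graph S"
    "(norm (a - x))\<^sup>2 / 2 + (norm (b - v))\<^sup>2 / 2 \<le> c - blinfun_apply v x"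
    using represents_near_graph[OF refl max rep c(1)] by blast
  then show thesis
    using that[of a b v] v(1) c(2) zero_le_power2[of "norm (a - x)"] zero_le_power2[of "norm (b - v)"]
    by linarith
qed

section \<open>Coercivity\<close>

lemma not_tendsto_PInfty_at_infinity:
  fixes g :: "'a::real_normed_vector \<Rightarrow> ereal"
  assumes "\<not> (g \<longlongrightarrow> \<infinity>) at_infinity"
  obtains r where "\<And>k. \<exists>x. k \<le> norm x \<and> g x \<le> ereal r"
  using assms unfolding tendsto_PInfty eventually_at_infinity by (metis not_less)

text \<open>Exempting the origin does not affect a limit at infinity and avoids division by
  \<open>norm 0\<close> when \<open>g\<close> is the quotient for supercoercivity.\<close>

lemma tendsto_PInfty_at_infinity_if_bounded:
  fixes g :: "'a::real_normed_vector \<Rightarrow> ereal"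
  assumes "bounded D" and "\<And>x. x \<notin> D \<Longrightarrow> x \<noteq> 0 \<Longrightarrow> g x = \<infinity>"
  shows "(g \<longlongrightarrow> \<infinity>) at_infinity"
proof (rule ccontr)
  assume "\<not> (g \<longlongrightarrow> \<infinity>) at_infinity"
  then obtain r where r: "\<And>k. \<exists>x. k \<le> norm x \<and> g x \<le> ereal r"
    using not_tendsto_PInfty_at_infinity by blast
  obtain B where B: "\<And>x. x \<in> D \<Longrightarrow> norm x \<le> B" using assms(1) unfolding bounded_iff by blast
  obtain x where x: "\<bar>B\<bar> + 1 \<le> norm x" "g x \<le> ereal r" using r by blast
  then have "x \<notin> D" "x \<noteq> 0" using B[of x] by auto
  then show False using assms(2) x(2) by auto
qed

lemma not_at_top_if_bounded:
  fixes f :: "nat \<Rightarrow> real"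
  assumes "\<And>n. f n \<le> B"
  shows "\<not> filterlim f at_top sequentially"
proof
  assume "filterlim f at_top sequentially"
  then have "eventually (\<lambda>n. B + 1 \<le> f n) sequentially" by (simp add: filterlim_at_top)
  then obtain n where "B + 1 \<le> f n" by (auto simp: eventually_sequentially)
  then show False using assms[of n] by simp
qed

lemma at_top_if_ge_real:
  fixes f :: "nat \<Rightarrow> real"
  assumes "0 < c" and "\<And>n. c * real n - d \<le> f n"
  shows "filterlim f at_top sequentially"
proof (rule filterlim_at_top_mono)
  show "filterlim (\<lambda>n. - d + c * real n) at_top sequentially"
    using assms(1)
    by (intro filterlim_tendsto_add_at_top[OF tendsto_const]
        filterlim_tendsto_pos_mult_at_top[OF tendsto_const] filterlim_real_sequentially)
  have "- d + c * real n \<le> f n" for n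
    using assms(2)[of n] by linarith
  then show "\<forall>\<^sub>F n in sequentially. - d + c * real n \<le> f n" by simp
qed

theorem theorem4p5:
  fixes S T :: "'a::banach \<Rightarrow> 'a dual set"
    and h :: "'a \<times> 'a dual \<Rightarrow> ereal"
    and y :: 'a
  assumes "reflexive_space TYPE('a)"
    and "maximally_monotone S"
    and "represents h S"
    and "y \<in> op_dom T"
  shows "(bounded (op_dom S) \<longrightarrow>
            supercoercive (\<lambda>x. bregman_dist S T h x y) \<and>
            coercive (\<lambda>x. bregman_dist S T h x y)) \<and>
         (compact (T y) \<longrightarrow>
            (coercive_operator S \<longrightarrow> coercive (\<lambda>x. bregman_dist S T h x y)) \<and>
            ((\<forall>a b. (\<forall>n::nat. (a n, b n) \<in> op_graph S) \<longrightarrow>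
                filterlim (\<lambda>n. norm (a n)) at_top sequentially \<longrightarrow>
                filterlim (\<lambda>n. (norm (b n))\<^sup>2 / norm (a n)) at_top sequentially) \<longrightarrow>
              supercoercive (\<lambda>x. bregman_dist S T h x y)))"
proof (intro conjI impI)
  note near = bregman_dist_near_graph[OF assms(1,2,3), of T _ y]
  {
    assume bd: "bounded (op_dom S)"
    show "supercoercive (\<lambda>x. bregman_dist S T h x y)"
      unfolding supercoercive_def
      by (rule tendsto_PInfty_at_infinity_if_bounded[OF bd]) (simp add: bregman_dist_def)
    show "coercive (\<lambda>x. bregman_dist S T h x y)"
      unfolding coercive_def
      by (rule tendsto_PInfty_at_infinity_if_bounded[OF bd]) (simp add: bregman_dist_def)
  next
    assume "compact (T y)" and S: "coercive_operator S"
    then obtain K where K: "\<And>v. v \<in> T y \<Longrightarrow> norm v \<le> K"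
      using compact_imp_bounded bounded_iff by metis
    show "coercive (\<lambda>x. bregman_dist S T h x y)"
      unfolding coercive_def
    proof (rule ccontr)
      assume "\<not> ((\<lambda>x. bregman_dist S T h x y) \<longlongrightarrow> \<infinity>) at_infinity"
      then obtain r where r: "\<And>k. \<exists>x. k \<le> norm x \<and> bregman_dist S T h x y \<le> ereal r"
        using not_tendsto_PInfty_at_infinity by blast
      \<comment> \<open>Raising \<open>r\<close> by 1 turns the weak bound on the distance into the
        strict one that \<open>near\<close> requires.\<close>
      define R where "R = sqrt (2 * (r + 1))"
      have "\<exists>a b. (a, b) \<in> op_graph S \<and> real n - R \<le> norm a \<and> norm b \<le> K + R" for n
      proof -
        obtain x where x: "real n \<le> norm x" "bregman_dist S T h x y \<le> ereal r" using r by blast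
        have "bregman_dist S T h x y < ereal (r + 1)" using x(2) by (rule le_less_trans) simp
        then obtain a b v where ab: "(a, b) \<in> op_graph S" "v \<in> T y"
          "(norm (a - x))\<^sup>2 \<le> 2 * (r + 1)" "(norm (b - v))\<^sup>2 \<le> 2 * (r + 1)"
          by (rule near)
        have "norm (a - x) \<le> R" "norm (b - v) \<le> R"
          using ab(3,4) by (auto simp: R_def intro: real_le_rsqrt)
        then have "real n - R \<le> norm a" "norm b \<le> K + R"
          using x(1) K[OF ab(2)] norm_triangle_ineq2[of x a] norm_triangle_ineq2[of b v]
          by (auto simp: norm_minus_commute)
        then show ?thesis using ab(1) by blast
      qed
      then obtain a b where ab: "\<And>n. (a n, b n) \<in> op_graph S"
        "\<And>n. real n - R \<le> norm (a n)" "\<And>n. norm (b n) \<le> K + R" by metis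
      have "filterlim (\<lambda>n. norm (a n)) at_top sequentially"
        using at_top_if_ge_real[of 1 R] ab(2) by simp
      then have "filterlim (\<lambda>n. norm (b n)) at_top sequentially"
        using S ab(1) unfolding coercive_operator_def by blast
      then show False using not_at_top_if_bounded[of "\<lambda>n. norm (b n)"] ab(3) by blast
    qed
  next
    assume "compact (T y)" and S: "\<forall>a b. (\<forall>n::nat. (a n, b n) \<in> op_graph S) \<longrightarrow>
      filterlim (\<lambda>n. norm (a n)) at_top sequentially \<longrightarrow>
      filterlim (\<lambda>n. (norm (b n))\<^sup>2 / norm (a n)) at_top sequentially"
    then obtain K where K: "\<And>v. v \<in> T y \<Longrightarrow> norm v \<le> K"
      using compact_imp_bounded bounded_iff by metis
    show "supercoercive (\<lambda>x. bregman_dist S T h x y)"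
      unfolding supercoercive_def
    proof (rule ccontr)
      assume "\<not> ((\<lambda>x. bregman_dist S T h x y / ereal (norm x)) \<longlongrightarrow> \<infinity>) at_infinity"
      then obtain r where r: "\<And>k. \<exists>x. k \<le> norm x \<and> bregman_dist S T h x y / ereal (norm x) \<le> ereal r"
        using not_tendsto_PInfty_at_infinity by blast
      \<comment> \<open>\<open>R\<close> is strictly above \<open>r\<close>, for the strict bound in
        \<open>near\<close>, and positive even if \<open>r\<close> is not.\<close>
      define R where "R = \<bar>r\<bar> + 1"
      have R: "1 \<le> R" "r < R" by (auto simp: R_def)
      have "\<exists>a b. (a, b) \<in> op_graph S \<and> (1/2) * real n + 1 \<le> norm a \<and>
          (norm b)\<^sup>2 / norm a \<le> 2 * K\<^sup>2 + 8 * R" for n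
      proof -
        \<comment> \<open>With \<open>8 * R \<le> norm x\<close> the error bound
          \<open>2 * R * norm x\<close> is at most \<open>(norm x / 2)\<^sup>2\<close>, so
          \<open>norm a\<close> is at least half of \<open>norm x\<close>.\<close>
        obtain x where x: "real n + 8 * R \<le> norm x"
          "bregman_dist S T h x y / ereal (norm x) \<le> ereal r" using r by blast
        have nx: "0 < norm x" using x(1) R by linarith
        have "bregman_dist S T h x y \<le> ereal (r * norm x)"
          using x(2) nx by (cases "bregman_dist S T h x y") (auto simp: divide_simps)
        also have "\<dots> < ereal (R * norm x)" using R nx by simp
        finally obtain a b v where ab: "(a, b) \<in> op_graph S" "v \<in> T y"
          "(norm (a - x))\<^sup>2 \<le> 2 * (R * norm x)" "(norm (b - v))\<^sup>2 \<le> 2 * (R * norm x)"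
          by (rule near)
        have "8 * R * norm x \<le> norm x * norm x"
          using x(1) nx by (intro mult_right_mono) auto
        then have "(norm (a - x))\<^sup>2 \<le> (norm x / 2)\<^sup>2"
          using ab(3) by (simp add: power2_eq_square)
        then have "norm (a - x) \<le> norm x / 2"
          by (rule power2_le_imp_le) simp
        then have na: "norm x / 2 \<le> norm a"
          using norm_triangle_ineq2[of x a] by (simp add: norm_minus_commute)
        have a1: "(1/2) * real n + 1 \<le> norm a" using na x(1) R by linarith
        have "norm b \<le> norm v + norm (b - v)" using norm_triangle_ineq2[of b v] by simp
        then have "(norm b)\<^sup>2 \<le> (norm v + norm (b - v))\<^sup>2" by (intro power_mono) auto
        also have "\<dots> \<le> 2 * (norm v)\<^sup>2 + 2 * (norm (b - v))\<^sup>2"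
          using sum_squares_bound[of "norm v" "norm (b - v)"] by (simp add: power2_sum)
        also have "\<dots> \<le> 2 * K\<^sup>2 + 2 * (2 * (R * norm x))"
          using ab(4) K[OF ab(2)] by (intro add_mono mult_left_mono power_mono) auto
        \<comment> \<open>Both terms become multiples of \<open>norm a\<close>, by
          \<open>1 \<le> norm a\<close> and \<open>norm x \<le> 2 * norm a\<close>, so the quotient
          is bounded independently of \<open>n\<close>.\<close>
        also have "\<dots> \<le> 2 * K\<^sup>2 * norm a + 8 * R * norm a"
        proof (rule add_mono)
          show "2 * K\<^sup>2 \<le> 2 * K\<^sup>2 * norm a" using a1 by (intro mult_le_cancel_left1[THEN iffD2]) auto
          show "2 * (2 * (R * norm x)) \<le> 8 * R * norm a"
            using mult_left_mono[OF na, of "8 * R"] R by simp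
        qed
        finally have "(norm b)\<^sup>2 / norm a \<le> 2 * K\<^sup>2 + 8 * R"
          using a1 by (subst pos_divide_le_eq) (auto simp: algebra_simps)
        then show ?thesis using ab(1) a1 by blast
      qed
      then obtain a b where ab: "\<And>n. (a n, b n) \<in> op_graph S"
        "\<And>n. (1/2) * real n + 1 \<le> norm (a n)"
        "\<And>n. (norm (b n))\<^sup>2 / norm (a n) \<le> 2 * K\<^sup>2 + 8 * R" by metis
      have "filterlim (\<lambda>n. norm (a n)) at_top sequentially"
        using at_top_if_ge_real[of "1/2" "- 1"] ab(2) by simp
      then have "filterlim (\<lambda>n. (norm (b n))\<^sup>2 / norm (a n)) at_top sequentially"
        using S ab(1) by blast
      then show False using not_at_top_if_bounded[of "\<lambda>n. (norm (b n))\<^sup>2 / norm (a n)"] ab(3) by blast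
    qed
  }
qed

end
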